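(* Let $\mathbb X$ be a category, $T:\mathbb X\to\mathbb X$ a functor, and $p:T\Rightarrow 1_{\mathbb X}$, $0:1_{\mathbb X}\Rightarrow T$ natural transformations such that $0$ is a section of $p$. Let $\mathbb G=(G\rightrightarrows M)$ be a groupoid in $\mathbb X$. Then the function $$(-)^{\vee}:\mathsf{LeftInv}(G,T^sG)\to\Gamma(M,T^s_MG)$$ has inverse $$(-)^{\wedge}:\Gamma(M,T^s_MG)\to\mathsf{LeftInv}(G,T^sG).$$ That is, $(v^{\wedge})^{\vee}=v$ for every $v\in\Gamma(M,T^s_MG)$ and $(X^{\vee})^{\wedge}=X$ for every $X\in\mathsf{LeftInv}(G,T^sG)$.
   Context: Composition is written in diagrammatic order: $fg$ means first $f$, then $g$. Components of natural transformations are written without subscripts, $(f,g,\dots)$ denotes the arrow into a pullback induced by $f,g,\dots$, and $\pi_0,\pi_1$ are the projections of a pullback. That $0$ is a section of $p$ means $0p=1$. The groupoid $\mathbb G$ has source and target $s,t:G\to M$, identity $e:M\to G$, inverse $(-)^{-1}$ and composition $\mu:G\,{}_t\!\times_s G\to G$, with $\mu s=\pi_0 s$, $\mu t=\pi_1 t$, $(1_G,te)\mu=1_G=(se,1_G)\mu$, and $\mu$ associative. All pullbacks mentioned are assumed to exist and to be preserved by $T$; in particular $T(G\,{}_t\!\times_s G)$ is the pullback $TG\,{}_{Tt}\!\times_{Ts}TG$. Definitions. $T^sG$, with projections $\iota^s:T^sG\to TG$ and $\pi^s:T^sG\to M$, is the pullback of $Ts:TG\to TM$ along $0:M\to TM$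 (so $\iota^s\,Ts=\pi^s0$); $p^s:=\iota^s p:T^sG\to G$. $T^s_MG$, with projections $\iota_M:T^s_MG\to T^sG$ and $\pi^s_M:T^s_MG\to M$, is the pullback of $p^s$ along $e:M\to G$ (so $\iota_M p^s=\pi^s_M e$). $\mu^s:G\,{}_t\!\times_{\pi^s}T^sG\to T^sG$ is the unique arrow with $\mu^s\iota^s=(\pi_00,\pi_1\iota^s)\,T\mu$ (and $\mu^s\pi^s=\pi_0s$). $\Gamma(M,T^s_MG)$ is the set of sections of $\pi^s_M$, i.e. arrows $v:M\to T^s_MG$ with $v\pi^s_M=1_M$. $\mathsf{LeftInv}(G,T^sG)$ is the set of left invariant vector fields: arrows $X:G\to T^sG$ with $Xp^s=1_G$ such that $(\pi_0,\pi_1X)\mu^s=\mu X$ as arrows $G\,{}_t\!\times_s G\to T^sG$. For $v\in\Gamma(M,T^s_MG)$, $v^{\wedge}:=(1_G,tv\iota_M)\mu^s:G\to T^sG$; it is a left invariant vector field. For a section $X$ of $p^s$, $X^{\vee}:M\to T^s_MG$ is the unique arrow with $X^{\vee}\pi^s_M=1_M$ and $X^{\vee}\iota_M=eX$ (it exists since $eXp^s=e$). *)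

theory Defs
  imports Main
begin

section \<open>Categories, functors, natural transformations\<close>

text \<open>
  Composition is written in diagrammatic order. It is a total function of the ambient type,
  and only its values on composable arrows are constrained.
\<close>

record ('o, 'm) category_data =
  Obj :: "'o set"
  Arr :: "'m set"
  Dom :: "'m \<Rightarrow> 'o"
  Cod :: "'m \<Rightarrow> 'o"
  Ide :: "'o \<Rightarrow> 'm"
  Comp :: "'m \<Rightarrow> 'm \<Rightarrow> 'm"  (infixl "\<cdot>\<index>" 70)

definition hom :: "('o, 'm) category_data \<Rightarrow> 'o \<Rightarrow> 'o \<Rightarrow> 'm set" where
  "hom C a b = {f \<in> Arr C. Dom C f = a \<and> Cod C f = b}"

locale category =
  fixes C :: "('o, 'm) category_data" (structure)
  assumes Dom_Obj: "f \<in> Arr C \<Longrightarrow> Dom C f \<in> Obj C"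
    and Cod_Obj: "f \<in> Arr C \<Longrightarrow> Cod C f \<in> Obj C"
    and Ide_hom: "a \<in> Obj C \<Longrightarrow> Ide C a \<in> hom C a a"
    and Comp_hom: "f \<in> hom C a b \<Longrightarrow> g \<in> hom C b c \<Longrightarrow> f \<cdot> g \<in> hom C a c"
    and Ide_Comp: "f \<in> hom C a b \<Longrightarrow> Ide C a \<cdot> f = f"
    and Comp_Ide: "f \<in> hom C a b \<Longrightarrow> f \<cdot> Ide C b = f"
    and Comp_assoc: "f \<in> hom C a b \<Longrightarrow> g \<in> hom C b c \<Longrightarrow> h \<in> hom C c d \<Longrightarrow>
      (f \<cdot> g) \<cdot> h = f \<cdot> (g \<cdot> h)"

record ('o, 'm) endofunctor_data =
  fobj :: "'o \<Rightarrow> 'o"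
  farr :: "'m \<Rightarrow> 'm"

locale endofunctor = category C for C :: "('o, 'm) category_data" (structure) +
  fixes F :: "('o, 'm) endofunctor_data"
  assumes fobj_Obj: "a \<in> Obj C \<Longrightarrow> fobj F a \<in> Obj C"
    and farr_hom: "f \<in> hom C a b \<Longrightarrow> farr F f \<in> hom C (fobj F a) (fobj F b)"
    and farr_Ide: "a \<in> Obj C \<Longrightarrow> farr F (Ide C a) = Ide C (fobj F a)"
    and farr_Comp: "f \<in> hom C a b \<Longrightarrow> g \<in> hom C b c \<Longrightarrow> farr F (f \<cdot> g) = farr F f \<cdot> farr F g"

definition identity_functor :: "('o, 'm) endofunctor_data" where
  "identity_functor = \<lparr>fobj = (\<lambda>a. a), farr = (\<lambda>f. f)\<rparr>"

locale natural_transformation = F: endofunctor C F + H: endofunctor C H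
  for C :: "('o, 'm) category_data" (structure) and F H :: "('o, 'm) endofunctor_data" +
  fixes \<alpha> :: "'o \<Rightarrow> 'm"
  assumes component_hom: "a \<in> Obj C \<Longrightarrow> \<alpha> a \<in> hom C (fobj F a) (fobj H a)"
    and naturality: "f \<in> hom C a b \<Longrightarrow> farr F f \<cdot> \<alpha> b = \<alpha> a \<cdot> farr H f"

section \<open>Pullbacks\<close>

record ('o, 'm) span =
  Apex :: 'o
  \<pi>\<^sub>0 :: 'm
  \<pi>\<^sub>1 :: 'm

definition is_pullback :: "('o, 'm) category_data \<Rightarrow> 'm \<Rightarrow> 'm \<Rightarrow> ('o, 'm) span \<Rightarrow> bool" where
  "is_pullback C f g P \<longleftrightarrow>
     f \<in> Arr C \<and> g \<in> Arr C \<and> Cod C f = Cod C g \<and>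
     Apex P \<in> Obj C \<and>
     \<pi>\<^sub>0 P \<in> hom C (Apex P) (Dom C f) \<and> \<pi>\<^sub>1 P \<in> hom C (Apex P) (Dom C g) \<and>
     \<pi>\<^sub>0 P \<cdot>\<^bsub>C\<^esub> f = \<pi>\<^sub>1 P \<cdot>\<^bsub>C\<^esub> g \<and>
     (\<forall>x \<in> Obj C. \<forall>a \<in> hom C x (Dom C f). \<forall>b \<in> hom C x (Dom C g).
        a \<cdot>\<^bsub>C\<^esub> f = b \<cdot>\<^bsub>C\<^esub> g \<longrightarrow>
        (\<exists>!h. h \<in> hom C x (Apex P) \<and> h \<cdot>\<^bsub>C\<^esub> \<pi>\<^sub>0 P = a \<and> h \<cdot>\<^bsub>C\<^esub> \<pi>\<^sub>1 P = b))"

text \<open>The arrow \<open>(a, b)\<close> into a pullback; meaningful only when \<open>a\<close> and \<open>b\<close> form a cone.\<close>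

definition induced :: "('o, 'm) category_data \<Rightarrow> ('o, 'm) span \<Rightarrow> 'm \<Rightarrow> 'm \<Rightarrow> 'm" where
  "induced C P a b =
     (THE h. h \<in> hom C (Dom C a) (Apex P) \<and> h \<cdot>\<^bsub>C\<^esub> \<pi>\<^sub>0 P = a \<and> h \<cdot>\<^bsub>C\<^esub> \<pi>\<^sub>1 P = b)"

definition map_span :: "('o, 'm) endofunctor_data \<Rightarrow> ('o, 'm) span \<Rightarrow> ('o, 'm) span" where
  "map_span F P = \<lparr>Apex = fobj F (Apex P), \<pi>\<^sub>0 = farr F (\<pi>\<^sub>0 P), \<pi>\<^sub>1 = farr F (\<pi>\<^sub>1 P)\<rparr>"

definition preserves_pullback ::
  "('o, 'm) category_data \<Rightarrow> ('o, 'm) endofunctor_data \<Rightarrow> 'm \<Rightarrow> 'm \<Rightarrow> ('o, 'm) span \<Rightarrow> bool" where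
  "preserves_pullback C F f g P \<longleftrightarrow> is_pullback C (farr F f) (farr F g) (map_span F P)"

section \<open>Internal groupoids\<close>

text \<open>
  The object of composable pairs \<open>Pairs\<close> is the pullback of the target along the source. The object
  of composable triples \<open>Triples\<close>, needed to express associativity, is the pullback of
  \<open>\<pi>\<^sub>1 t\<close> (the target of the second component of a composable pair) along the source.
\<close>

record ('o, 'm) groupoid_data =
  Base :: 'o
  Total :: 'o
  src :: 'm
  tgt :: 'm
  unit :: 'm
  ginv :: 'm
  mult :: 'm
  Pairs :: "('o, 'm) span"
  Triples :: "('o, 'm) span"

locale internal_groupoid = category C for C :: "('o, 'm) category_data" (structure) +
  fixes \<G> :: "('o, 'm) groupoid_data"
  assumes Base_Obj: "Base \<G> \<in> Obj C"
    and Total_Obj: "Total \<G> \<in> Obj C"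
    and src_hom: "src \<G> \<in> hom C (Total \<G>) (Base \<G>)"
    and tgt_hom: "tgt \<G> \<in> hom C (Total \<G>) (Base \<G>)"
    and unit_hom: "unit \<G> \<in> hom C (Base \<G>) (Total \<G>)"
    and ginv_hom: "ginv \<G> \<in> hom C (Total \<G>) (Total \<G>)"
    and Pairs_pullback: "is_pullback C (tgt \<G>) (src \<G>) (Pairs \<G>)"
    and Triples_pullback: "is_pullback C (\<pi>\<^sub>1 (Pairs \<G>) \<cdot> tgt \<G>) (src \<G>) (Triples \<G>)"
    and mult_hom: "mult \<G> \<in> hom C (Apex (Pairs \<G>)) (Total \<G>)"
    and unit_src: "unit \<G> \<cdot> src \<G> = Ide C (Base \<G>)"
    and unit_tgt: "unit \<G> \<cdot> tgt \<G> = Ide C (Base \<G>)"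
    and mult_src: "mult \<G> \<cdot> src \<G> = \<pi>\<^sub>0 (Pairs \<G>) \<cdot> src \<G>"
    and mult_tgt: "mult \<G> \<cdot> tgt \<G> = \<pi>\<^sub>1 (Pairs \<G>) \<cdot> tgt \<G>"
    and mult_unit_right:
      "induced C (Pairs \<G>) (Ide C (Total \<G>)) (tgt \<G> \<cdot> unit \<G>) \<cdot> mult \<G> = Ide C (Total \<G>)"
    and mult_unit_left:
      "induced C (Pairs \<G>) (src \<G> \<cdot> unit \<G>) (Ide C (Total \<G>)) \<cdot> mult \<G> = Ide C (Total \<G>)"
    and mult_assoc:
      "induced C (Pairs \<G>) (\<pi>\<^sub>0 (Triples \<G>) \<cdot> mult \<G>) (\<pi>\<^sub>1 (Triples \<G>)) \<cdot> mult \<G> =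
       induced C (Pairs \<G>) (\<pi>\<^sub>0 (Triples \<G>) \<cdot> \<pi>\<^sub>0 (Pairs \<G>))
         (induced C (Pairs \<G>) (\<pi>\<^sub>0 (Triples \<G>) \<cdot> \<pi>\<^sub>1 (Pairs \<G>)) (\<pi>\<^sub>1 (Triples \<G>)) \<cdot> mult \<G>) \<cdot> mult \<G>"
    and ginv_src: "ginv \<G> \<cdot> src \<G> = tgt \<G>"
    and ginv_tgt: "ginv \<G> \<cdot> tgt \<G> = src \<G>"
    and mult_ginv_right:
      "induced C (Pairs \<G>) (Ide C (Total \<G>)) (ginv \<G>) \<cdot> mult \<G> = src \<G> \<cdot> unit \<G>"
    and mult_ginv_left:
      "induced C (Pairs \<G>) (ginv \<G>) (Ide C (Total \<G>)) \<cdot> mult \<G> = tgt \<G> \<cdot> unit \<G>"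

section \<open>Left invariant vector fields\<close>

text \<open>
  In what follows \<open>T\<close> is the endofunctor, \<open>p : T \<Rightarrow> 1\<close> and \<open>z : 1 \<Rightarrow> T\<close> (the zero section, \<open>0\<close>)
  are given by their components, and the spans are (arbitrarily chosen) pullbacks:
  \<^item> \<open>TsG\<close>, standing for \<open>T\<^sup>sG\<close>, is the pullback of \<open>T s\<close> along \<open>0 : M \<rightarrow> TM\<close>;
    \<open>\<pi>\<^sub>0 TsG\<close> is \<open>\<iota>\<^sup>s\<close> and \<open>\<pi>\<^sub>1 TsG\<close> is \<open>\<pi>\<^sup>s\<close>.
  \<^item> \<open>TsMG\<close>, standing for \<open>T\<^sup>s\<^sub>MG\<close>, is the pullback of \<open>p\<^sup>s\<close> along \<open>e\<close>;
    \<open>\<pi>\<^sub>0 TsMG\<close> is \<open>\<iota>\<^sub>M\<close> and \<open>\<pi>\<^sub>1 TsMG\<close> is \<open>\<pi>\<^sup>s\<^sub>M\<close>.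
  \<^item> \<open>GTsG\<close> is the pullback of \<open>t\<close> along \<open>\<pi>\<^sup>s\<close>, the domain of the action \<open>\<mu>\<^sup>s\<close>.
\<close>

definition p_s ::
  "('o, 'm) category_data \<Rightarrow> ('o \<Rightarrow> 'm) \<Rightarrow> ('o, 'm) groupoid_data \<Rightarrow> ('o, 'm) span \<Rightarrow> 'm" where
  "p_s C p \<G> TsG = \<pi>\<^sub>0 TsG \<cdot>\<^bsub>C\<^esub> p (Total \<G>)"

text \<open>
  The inner pairing lands in \<open>T\<close> of the object of composable pairs, with projections \<open>T \<pi>\<^sub>0\<close> and
  \<open>T \<pi>\<^sub>1\<close>. The outer one encodes the two equations \<open>\<mu>\<^sup>s \<iota>\<^sup>s = (\<pi>\<^sub>0 0, \<pi>\<^sub>1 \<iota>\<^sup>s) T\<mu>\<close> and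
  \<open>\<mu>\<^sup>s \<pi>\<^sup>s = \<pi>\<^sub>0 s\<close> determining \<open>\<mu>\<^sup>s\<close>.
\<close>

definition mu_s ::
  "('o, 'm) category_data \<Rightarrow> ('o, 'm) endofunctor_data \<Rightarrow> ('o \<Rightarrow> 'm) \<Rightarrow> ('o, 'm) groupoid_data \<Rightarrow>
   ('o, 'm) span \<Rightarrow> ('o, 'm) span \<Rightarrow> 'm" where
  "mu_s C T z \<G> TsG GTsG =
     induced C TsG
       (induced C (map_span T (Pairs \<G>))
          (\<pi>\<^sub>0 GTsG \<cdot>\<^bsub>C\<^esub> z (Total \<G>)) (\<pi>\<^sub>1 GTsG \<cdot>\<^bsub>C\<^esub> \<pi>\<^sub>0 TsG)
        \<cdot>\<^bsub>C\<^esub> farr T (mult \<G>))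
       (\<pi>\<^sub>0 GTsG \<cdot>\<^bsub>C\<^esub> src \<G>)"

definition sections ::
  "('o, 'm) category_data \<Rightarrow> ('o, 'm) groupoid_data \<Rightarrow> ('o, 'm) span \<Rightarrow> 'm set" where
  "sections C \<G> TsMG =
     {v \<in> hom C (Base \<G>) (Apex TsMG). v \<cdot>\<^bsub>C\<^esub> \<pi>\<^sub>1 TsMG = Ide C (Base \<G>)}"

definition LeftInv ::
  "('o, 'm) category_data \<Rightarrow> ('o, 'm) endofunctor_data \<Rightarrow> ('o \<Rightarrow> 'm) \<Rightarrow> ('o \<Rightarrow> 'm) \<Rightarrow>
   ('o, 'm) groupoid_data \<Rightarrow> ('o, 'm) span \<Rightarrow> ('o, 'm) span \<Rightarrow> 'm set" where
  "LeftInv C T p z \<G> TsG GTsG =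
     {X \<in> hom C (Total \<G>) (Apex TsG).
        X \<cdot>\<^bsub>C\<^esub> p_s C p \<G> TsG = Ide C (Total \<G>) \<and>
        induced C GTsG (\<pi>\<^sub>0 (Pairs \<G>)) (\<pi>\<^sub>1 (Pairs \<G>) \<cdot>\<^bsub>C\<^esub> X) \<cdot>\<^bsub>C\<^esub> mu_s C T z \<G> TsG GTsG =
          mult \<G> \<cdot>\<^bsub>C\<^esub> X}"

definition wedge ::
  "('o, 'm) category_data \<Rightarrow> ('o, 'm) endofunctor_data \<Rightarrow> ('o \<Rightarrow> 'm) \<Rightarrow> ('o, 'm) groupoid_data \<Rightarrow>
   ('o, 'm) span \<Rightarrow> ('o, 'm) span \<Rightarrow> ('o, 'm) span \<Rightarrow> 'm \<Rightarrow> 'm" where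
  "wedge C T z \<G> TsG TsMG GTsG v =
     induced C GTsG (Ide C (Total \<G>)) (tgt \<G> \<cdot>\<^bsub>C\<^esub> v \<cdot>\<^bsub>C\<^esub> \<pi>\<^sub>0 TsMG) \<cdot>\<^bsub>C\<^esub> mu_s C T z \<G> TsG GTsG"

definition vee ::
  "('o, 'm) category_data \<Rightarrow> ('o, 'm) groupoid_data \<Rightarrow> ('o, 'm) span \<Rightarrow> 'm \<Rightarrow> 'm" where
  "vee C \<G> TsMG X = induced C TsMG (unit \<G> \<cdot>\<^bsub>C\<^esub> X) (Ide C (Base \<G>))"

end

theory Submission
  imports Defs
begin

text \<open>
  Evaluating a left invariant vector field at a unit and spreading a vector at the units by left
  translation are mutually inverse because every arrow is the left translate of a
  unit, \<open>g = g \<odot> 1\<close>. In a groupoid of sets the two verifications read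
  \<open>1 \<star> v = v\<close> and \<open>g \<star> X(1) = X(g \<odot> 1) = X(g)\<close>, where \<open>\<star>\<close> is the action \<open>\<mu>\<^sup>s\<close> of
  the groupoid on its source-vertical tangent vectors, and \<open>g \<mapsto> g \<star> v\<close> is left invariant because
  \<open>(g \<odot> h) \<star> v = g \<star> (h \<star> v)\<close>. So all that matters is that \<open>\<star>\<close> is a unital, associative action
  covering left multiplication on the feet of the vectors.

  The proof transports this argument to an arbitrary category by means of generalized elements. The
  product \<open>gmult\<close> (later \<open>\<odot>\<close>) of two arrows into \<open>G\<close> obeys the set-theoretic groupoid laws, associativity
  (\<open>gmult_assoc\<close>) and the left unit law (\<open>gmult_unit_left\<close>), and commutes with reparametrization
  (\<open>Comp_gmult\<close>). As \<open>T\<close> preserves the pullbacks involved, \<open>TG\<close> is a groupoid as well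
  (\<open>internal_groupoid_map_groupoid\<close>), so that the same laws hold for its product \<open>\<bullet>\<close>.

  The action is \<open>g \<star> Y = 0\<^sub>g \<bullet> Y\<close>, computed in \<open>TG\<close> (\<open>act_iota\<close>). Naturality of \<open>0\<close> and \<open>p\<close> makes
  both of them multiplicative (\<open>gmult_zero\<close>, \<open>gmult_p\<close>), whence
  \<open>0\<^bsub>g \<odot> h\<^esub> \<bullet> Y = (0\<^sub>g \<bullet> 0\<^sub>h) \<bullet> Y = 0\<^sub>g \<bullet> (0\<^sub>h \<bullet> Y)\<close> gives associativity of the action (\<open>act_assoc\<close>), the
  fact that \<open>0\<close> carries units to units gives \<open>act_unit\<close>, and applying \<open>p\<close> with \<open>0p = 1\<close> gives
  \<open>act_foot\<close>.
\<close>

section \<open>Composable arrows and arrows into a pullback\<close>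

context category
begin

lemma Comp_simps:
  assumes "f \<in> Arr C" "g \<in> Arr C" "Cod C f = Dom C g"
  shows "f \<cdot> g \<in> Arr C" and "Dom C (f \<cdot> g) = Dom C f" and "Cod C (f \<cdot> g) = Cod C g"
  using Comp_hom[of f "Dom C f" "Cod C f" g "Cod C g"] assms by (auto simp: hom_def)

lemma Comp_assoc_seq:
  assumes "f \<in> Arr C" "g \<in> Arr C" "h \<in> Arr C" "Cod C f = Dom C g" "Cod C g = Dom C h"
  shows "(f \<cdot> g) \<cdot> h = f \<cdot> (g \<cdot> h)"
  using Comp_assoc[of f "Dom C f" "Cod C f" g "Cod C g" h "Cod C h"] assms by (auto simp: hom_def)

lemma Ide_simps:
  assumes "a \<in> Obj C"
  shows "Ide C a \<in> Arr C" "Dom C (Ide C a) = a" "Cod C (Ide C a) = a"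
  using Ide_hom[OF assms] by (auto simp: hom_def)

lemma Ide_Comp_Dom: "f \<in> Arr C \<Longrightarrow> Dom C f = a \<Longrightarrow> Ide C a \<cdot> f = f"
  using Ide_Comp[of f a "Cod C f"] by (simp add: hom_def)

lemma Comp_Ide_Cod: "f \<in> Arr C \<Longrightarrow> Cod C f = a \<Longrightarrow> f \<cdot> Ide C a = f"
  using Comp_Ide[of f "Dom C f" a] by (simp add: hom_def)

text \<open>
  Deciding composability by computing domains and codomains, rather than by guessing intermediate
  objects, lets the simplifier bring every composite into right-associated form.
\<close>

lemmas arrow_simps = Comp_simps Comp_assoc_seq Ide_simps Ide_Comp_Dom Comp_Ide_Cod

lemma hom_Obj: "f \<in> hom C a b \<Longrightarrow> a \<in> Obj C" "f \<in> hom C a b \<Longrightarrow> b \<in> Obj C"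
  using Dom_Obj Cod_Obj by (auto simp: hom_def)

lemma hom_D: "f \<in> hom C a b \<Longrightarrow> f \<in> Arr C \<and> Dom C f = a \<and> Cod C f = b"
  by (simp add: hom_def)

lemma hom_I: "f \<in> Arr C \<Longrightarrow> Dom C f = a \<Longrightarrow> Cod C f = b \<Longrightarrow> f \<in> hom C a b"
  by (simp add: hom_def)

lemma pullback_projections:
  assumes "is_pullback C f g S"
  shows "\<pi>\<^sub>0 S \<in> hom C (Apex S) (Dom C f)" and "\<pi>\<^sub>1 S \<in> hom C (Apex S) (Dom C g)"
    and "\<pi>\<^sub>0 S \<cdot> f = \<pi>\<^sub>1 S \<cdot> g"
  using assms by (auto simp: is_pullback_def)

lemma induced_unique_existence:
  assumes "is_pullback C f g S"
    and "a \<in> hom C x (Dom C f)" "b \<in> hom C x (Dom C g)" "a \<cdot> f = b \<cdot> g"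
  shows "\<exists>!h. h \<in> hom C x (Apex S) \<and> h \<cdot> \<pi>\<^sub>0 S = a \<and> h \<cdot> \<pi>\<^sub>1 S = b"
  using assms hom_Obj(1)[OF assms(2)] by (auto simp: is_pullback_def)

lemma induced_into_pullback:
  assumes "is_pullback C f g S"
    and "a \<in> hom C x (Dom C f)" "b \<in> hom C x (Dom C g)" "a \<cdot> f = b \<cdot> g"
  shows "induced C S a b \<in> hom C x (Apex S)"
    and "induced C S a b \<cdot> \<pi>\<^sub>0 S = a" and "induced C S a b \<cdot> \<pi>\<^sub>1 S = b"
  using theI'[OF induced_unique_existence[OF assms]] hom_D[OF assms(2)]
  unfolding induced_def by auto

lemma pullback_eqI:
  assumes P: "is_pullback C f g S"
    and h: "h \<in> hom C x (Apex S)" and k: "k \<in> hom C x (Apex S)"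
    and eq: "h \<cdot> \<pi>\<^sub>0 S = k \<cdot> \<pi>\<^sub>0 S" "h \<cdot> \<pi>\<^sub>1 S = k \<cdot> \<pi>\<^sub>1 S"
  shows "h = k"
proof -
  note pr = pullback_projections[OF P]
  have fg: "f \<in> Arr C" "g \<in> Arr C" using P by (auto simp: is_pullback_def)
  have "(h \<cdot> \<pi>\<^sub>0 S) \<cdot> f = (h \<cdot> \<pi>\<^sub>1 S) \<cdot> g"
    using pr hom_D[OF h] hom_D[OF pr(1)] hom_D[OF pr(2)] fg by (simp add: arrow_simps)
  with induced_unique_existence[OF P Comp_hom[OF h pr(1)] Comp_hom[OF h pr(2)]] h k eq
  show ?thesis by auto
qed

lemma induced_eqI:
  assumes P: "is_pullback C f g S"
    and h: "h \<in> hom C x (Apex S)" and eq: "h \<cdot> \<pi>\<^sub>0 S = a" "h \<cdot> \<pi>\<^sub>1 S = b"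
  shows "induced C S a b = h"
proof -
  note pr = pullback_projections[OF P]
  have fg: "f \<in> Arr C" "g \<in> Arr C" using P by (auto simp: is_pullback_def)
  have "a \<cdot> f = b \<cdot> g"
    using pr hom_D[OF h] hom_D[OF pr(1)] hom_D[OF pr(2)] fg eq by (auto simp: arrow_simps)
  moreover have "a \<in> hom C x (Dom C f)" "b \<in> hom C x (Dom C g)"
    using Comp_hom[OF h] pr eq by auto
  ultimately show ?thesis
    using induced_into_pullback[OF P, of a x b] eq by (intro pullback_eqI[OF P _ h]) auto
qed

lemma Comp_induced:
  assumes P: "is_pullback C f g S"
    and ab: "a \<in> hom C x (Dom C f)" "b \<in> hom C x (Dom C g)" "a \<cdot> f = b \<cdot> g"
    and h: "h \<in> hom C y x"
  shows "h \<cdot> induced C S a b = induced C S (h \<cdot> a) (h \<cdot> b)"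
proof -
  note pr = pullback_projections[OF P] and ind = induced_into_pullback[OF P ab]
  show ?thesis
    using ind Comp_hom[OF h ind(1)] Comp_assoc[OF h ind(1)] pr
    by (intro induced_eqI[OF P, symmetric]) auto
qed

lemma induced_projections:
  assumes "is_pullback C f g S"
  shows "induced C S (\<pi>\<^sub>0 S) (\<pi>\<^sub>1 S) = Ide C (Apex S)"
  using assms Ide_hom Ide_Comp pullback_projections[OF assms]
  by (intro induced_eqI[OF assms]) (auto simp: is_pullback_def)

end

lemma (in endofunctor) farr_induced:
  assumes P: "is_pullback C f g S" and TP: "preserves_pullback C F f g S"
    and ab: "a \<in> hom C x (Dom C f)" "b \<in> hom C x (Dom C g)" "a \<cdot> f = b \<cdot> g"
  shows "farr F (induced C S a b) = induced C (map_span F S) (farr F a) (farr F b)"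
proof -
  note pr = pullback_projections[OF P] and ind = induced_into_pullback[OF P ab]
  show ?thesis
    using farr_hom[OF ind(1)] farr_Comp[OF ind(1) pr(1)] farr_Comp[OF ind(1) pr(2)] ind
    by (intro induced_eqI[OF TP[unfolded preserves_pullback_def], symmetric])
      (auto simp: map_span_def)
qed

section \<open>Multiplication of generalized elements of a groupoid\<close>

context internal_groupoid
begin

text \<open>
  A generalized element of shape \<open>x\<close> is an arrow \<open>x \<rightarrow> G\<close>. Multiplying generalized elements instead
  of manipulating arrows into \<open>Pairs\<close> and \<open>Triples\<close> turns the groupoid axioms into their familiar
  set-theoretic form, at the price of a composability condition.
\<close>

definition composable :: "'o \<Rightarrow> 'm \<Rightarrow> 'm \<Rightarrow> bool" where
  "composable x a b \<longleftrightarrow>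
     a \<in> hom C x (Total \<G>) \<and> b \<in> hom C x (Total \<G>) \<and> a \<cdot> tgt \<G> = b \<cdot> src \<G>"

definition gmult :: "'m \<Rightarrow> 'm \<Rightarrow> 'm" where
  "gmult a b = induced C (Pairs \<G>) a b \<cdot> mult \<G>"

lemmas structure_homs =
  src_hom[THEN hom_D] tgt_hom[THEN hom_D] unit_hom[THEN hom_D] ginv_hom[THEN hom_D]
  mult_hom[THEN hom_D]

lemma Pairs_projections:
  "\<pi>\<^sub>0 (Pairs \<G>) \<in> hom C (Apex (Pairs \<G>)) (Total \<G>)"
  "\<pi>\<^sub>1 (Pairs \<G>) \<in> hom C (Apex (Pairs \<G>)) (Total \<G>)"
  "\<pi>\<^sub>0 (Pairs \<G>) \<cdot> tgt \<G> = \<pi>\<^sub>1 (Pairs \<G>) \<cdot> src \<G>"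
  using pullback_projections[OF Pairs_pullback] structure_homs by auto

lemma induced_Pairs:
  assumes "composable x a b"
  shows "induced C (Pairs \<G>) a b \<in> hom C x (Apex (Pairs \<G>))"
    and "induced C (Pairs \<G>) a b \<cdot> \<pi>\<^sub>0 (Pairs \<G>) = a"
    and "induced C (Pairs \<G>) a b \<cdot> \<pi>\<^sub>1 (Pairs \<G>) = b"
  using induced_into_pullback[OF Pairs_pullback] assms structure_homs
  by (auto simp: composable_def)

lemma Comp_induced_Pairs:
  assumes "composable x a b" "h \<in> hom C y x"
  shows "h \<cdot> induced C (Pairs \<G>) a b = induced C (Pairs \<G>) (h \<cdot> a) (h \<cdot> b)"
  using Comp_induced[OF Pairs_pullback] assms structure_homs by (auto simp: composable_def)

lemma composable_Comp:
  assumes "composable x a b" "h \<in> hom C y x"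
  shows "composable y (h \<cdot> a) (h \<cdot> b)"
  using assms structure_homs
  by (auto simp: composable_def arrow_simps dest!: hom_D intro!: hom_I)

lemma composable_projections: "composable (Apex (Pairs \<G>)) (\<pi>\<^sub>0 (Pairs \<G>)) (\<pi>\<^sub>1 (Pairs \<G>))"
  using Pairs_projections by (simp add: composable_def)

lemma gmult_hom: "composable x a b \<Longrightarrow> gmult a b \<in> hom C x (Total \<G>)"
  unfolding gmult_def by (blast intro: Comp_hom induced_Pairs mult_hom)

lemma gmult_src:
  assumes "composable x a b"
  shows "gmult a b \<cdot> src \<G> = a \<cdot> src \<G>"
proof -
  note ind = induced_Pairs[OF assms]
  have "gmult a b \<cdot> src \<G> = induced C (Pairs \<G>) a b \<cdot> (\<pi>\<^sub>0 (Pairs \<G>) \<cdot> src \<G>)"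
    unfolding gmult_def mult_src[symmetric] by (rule Comp_assoc[OF ind(1) mult_hom src_hom])
  also have "\<dots> = a \<cdot> src \<G>"
    using Comp_assoc[OF ind(1) Pairs_projections(1) src_hom] ind by simp
  finally show ?thesis .
qed

lemma gmult_tgt:
  assumes "composable x a b"
  shows "gmult a b \<cdot> tgt \<G> = b \<cdot> tgt \<G>"
proof -
  note ind = induced_Pairs[OF assms]
  have "gmult a b \<cdot> tgt \<G> = induced C (Pairs \<G>) a b \<cdot> (\<pi>\<^sub>1 (Pairs \<G>) \<cdot> tgt \<G>)"
    unfolding gmult_def mult_tgt[symmetric] by (rule Comp_assoc[OF ind(1) mult_hom tgt_hom])
  also have "\<dots> = b \<cdot> tgt \<G>"
    using Comp_assoc[OF ind(1) Pairs_projections(2) tgt_hom] ind by simp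
  finally show ?thesis .
qed

lemma Comp_gmult:
  assumes "composable x a b" "h \<in> hom C y x"
  shows "h \<cdot> gmult a b = gmult (h \<cdot> a) (h \<cdot> b)"
  unfolding gmult_def Comp_induced_Pairs[OF assms, symmetric]
  by (rule Comp_assoc[OF assms(2) induced_Pairs(1)[OF assms(1)] mult_hom, symmetric])

lemma gmult_projections: "gmult (\<pi>\<^sub>0 (Pairs \<G>)) (\<pi>\<^sub>1 (Pairs \<G>)) = mult \<G>"
  unfolding gmult_def induced_projections[OF Pairs_pullback] by (rule Ide_Comp[OF mult_hom])

lemma composable_unit_right: "composable (Total \<G>) (Ide C (Total \<G>)) (tgt \<G> \<cdot> unit \<G>)"
  using structure_homs Total_Obj unit_src
  by (auto simp: composable_def arrow_simps intro!: hom_I)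

lemma composable_unit_left: "composable (Total \<G>) (src \<G> \<cdot> unit \<G>) (Ide C (Total \<G>))"
  using structure_homs Total_Obj unit_tgt
  by (auto simp: composable_def arrow_simps intro!: hom_I)

lemma composable_ginv_right: "composable (Total \<G>) (Ide C (Total \<G>)) (ginv \<G>)"
  using structure_homs Total_Obj ginv_src
  by (auto simp: composable_def arrow_simps intro!: hom_I)

lemma composable_ginv_left: "composable (Total \<G>) (ginv \<G>) (Ide C (Total \<G>))"
  using structure_homs Total_Obj ginv_tgt
  by (auto simp: composable_def arrow_simps intro!: hom_I)

lemma gmult_unit_left:
  assumes "a \<in> hom C x (Total \<G>)"
  shows "gmult (a \<cdot> src \<G> \<cdot> unit \<G>) a = a"
  using Comp_gmult[OF composable_unit_left assms] mult_unit_left hom_D[OF assms] structure_homs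
    Total_Obj
  by (simp add: gmult_def arrow_simps)

lemma Triples_projections:
  "\<pi>\<^sub>0 (Triples \<G>) \<in> hom C (Apex (Triples \<G>)) (Apex (Pairs \<G>))"
  "\<pi>\<^sub>1 (Triples \<G>) \<in> hom C (Apex (Triples \<G>)) (Total \<G>)"
  "\<pi>\<^sub>0 (Triples \<G>) \<cdot> (\<pi>\<^sub>1 (Pairs \<G>) \<cdot> tgt \<G>) = \<pi>\<^sub>1 (Triples \<G>) \<cdot> src \<G>"
  using pullback_projections[OF Triples_pullback] structure_homs Pairs_projections(2)[THEN hom_D]
  by (auto simp: arrow_simps)

text \<open>
  These conditions let \<open>Comp_gmult\<close> evaluate both sides of the associativity axiom at a given triple.
\<close>

lemma composable_Triples:
  shows "composable (Apex (Triples \<G>)) (\<pi>\<^sub>0 (Triples \<G>) \<cdot> \<pi>\<^sub>0 (Pairs \<G>))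
      (\<pi>\<^sub>0 (Triples \<G>) \<cdot> \<pi>\<^sub>1 (Pairs \<G>))"
    and "composable (Apex (Triples \<G>)) (\<pi>\<^sub>0 (Triples \<G>) \<cdot> \<pi>\<^sub>1 (Pairs \<G>)) (\<pi>\<^sub>1 (Triples \<G>))"
    and "composable (Apex (Triples \<G>)) (\<pi>\<^sub>0 (Triples \<G>) \<cdot> mult \<G>) (\<pi>\<^sub>1 (Triples \<G>))"
    and "composable (Apex (Triples \<G>)) (\<pi>\<^sub>0 (Triples \<G>) \<cdot> \<pi>\<^sub>0 (Pairs \<G>))
      (gmult (\<pi>\<^sub>0 (Triples \<G>) \<cdot> \<pi>\<^sub>1 (Pairs \<G>)) (\<pi>\<^sub>1 (Triples \<G>)))"
proof -
  note homs = Triples_projections(1,2)[THEN hom_D] Pairs_projections(1,2)[THEN hom_D]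
    structure_homs
  show 1: "composable (Apex (Triples \<G>)) (\<pi>\<^sub>0 (Triples \<G>) \<cdot> \<pi>\<^sub>0 (Pairs \<G>))
      (\<pi>\<^sub>0 (Triples \<G>) \<cdot> \<pi>\<^sub>1 (Pairs \<G>))"
    by (rule composable_Comp[OF composable_projections Triples_projections(1)])
  show 2: "composable (Apex (Triples \<G>)) (\<pi>\<^sub>0 (Triples \<G>) \<cdot> \<pi>\<^sub>1 (Pairs \<G>)) (\<pi>\<^sub>1 (Triples \<G>))"
    using homs Triples_projections(3) by (auto simp: composable_def arrow_simps intro!: hom_I)
  show "composable (Apex (Triples \<G>)) (\<pi>\<^sub>0 (Triples \<G>) \<cdot> mult \<G>) (\<pi>\<^sub>1 (Triples \<G>))"
    using homs Triples_projections(3) mult_tgt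
    by (auto simp: composable_def arrow_simps intro!: hom_I)
  show "composable (Apex (Triples \<G>)) (\<pi>\<^sub>0 (Triples \<G>) \<cdot> \<pi>\<^sub>0 (Pairs \<G>))
      (gmult (\<pi>\<^sub>0 (Triples \<G>) \<cdot> \<pi>\<^sub>1 (Pairs \<G>)) (\<pi>\<^sub>1 (Triples \<G>)))"
    using 1 gmult_hom[OF 2] gmult_src[OF 2] by (simp add: composable_def)
qed

text \<open>
  Three consecutive composable elements form an arrow into \<open>Triples\<close>; precomposing the associativity
  axiom with it yields associativity at these elements.
\<close>

lemma gmult_assoc:
  assumes ab: "composable x a b" and bc: "composable x b c"
  shows "gmult (gmult a b) c = gmult a (gmult b c)"
proof -
  note ind = induced_Pairs[OF ab]
  let ?ab = "induced C (Pairs \<G>) a b"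
  have dom: "Dom C (\<pi>\<^sub>1 (Pairs \<G>) \<cdot> tgt \<G>) = Apex (Pairs \<G>)"
    using Pairs_projections(2)[THEN hom_D] structure_homs by (simp add: arrow_simps)
  have "?ab \<cdot> (\<pi>\<^sub>1 (Pairs \<G>) \<cdot> tgt \<G>) = c \<cdot> src \<G>"
    using Comp_assoc[OF ind(1) Pairs_projections(2) tgt_hom] ind bc by (simp add: composable_def)
  then obtain h where h: "h \<in> hom C x (Apex (Triples \<G>))"
    and h0: "h \<cdot> \<pi>\<^sub>0 (Triples \<G>) = ?ab" and h1: "h \<cdot> \<pi>\<^sub>1 (Triples \<G>) = c"
    using induced_into_pullback[OF Triples_pullback, of ?ab x c] ind bc dom structure_homs
    by (auto simp: composable_def)
  note T = composable_Triples
  have h00: "h \<cdot> (\<pi>\<^sub>0 (Triples \<G>) \<cdot> \<pi>\<^sub>0 (Pairs \<G>)) = a"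
    using Comp_assoc[OF h Triples_projections(1) Pairs_projections(1)] h0 ind by simp
  have h01: "h \<cdot> (\<pi>\<^sub>0 (Triples \<G>) \<cdot> \<pi>\<^sub>1 (Pairs \<G>)) = b"
    using Comp_assoc[OF h Triples_projections(1) Pairs_projections(2)] h0 ind by simp
  have hm: "h \<cdot> (\<pi>\<^sub>0 (Triples \<G>) \<cdot> mult \<G>) = gmult a b"
    using Comp_assoc[OF h Triples_projections(1) mult_hom] h0 by (simp add: gmult_def)
  have "h \<cdot> (gmult (\<pi>\<^sub>0 (Triples \<G>) \<cdot> mult \<G>) (\<pi>\<^sub>1 (Triples \<G>))) =
      h \<cdot> (gmult (\<pi>\<^sub>0 (Triples \<G>) \<cdot> \<pi>\<^sub>0 (Pairs \<G>))
        (gmult (\<pi>\<^sub>0 (Triples \<G>) \<cdot> \<pi>\<^sub>1 (Pairs \<G>)) (\<pi>\<^sub>1 (Triples \<G>))))"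
    using mult_assoc by (simp add: gmult_def)
  then show ?thesis
    by (simp add: Comp_gmult[OF T(3) h] Comp_gmult[OF T(4) h] Comp_gmult[OF T(2) h] h00 h01 h1 hm)
qed

end

section \<open>The image of a groupoid under a functor\<close>

definition map_groupoid ::
  "('o, 'm) endofunctor_data \<Rightarrow> ('o, 'm) groupoid_data \<Rightarrow> ('o, 'm) groupoid_data" where
  "map_groupoid F \<G> =
     \<lparr>Base = fobj F (Base \<G>), Total = fobj F (Total \<G>), src = farr F (src \<G>),
      tgt = farr F (tgt \<G>), unit = farr F (unit \<G>), ginv = farr F (ginv \<G>),
      mult = farr F (mult \<G>), Pairs = map_span F (Pairs \<G>), Triples = map_span F (Triples \<G>)\<rparr>"

lemma map_span_simps [simp]:
  "Apex (map_span F S) = fobj F (Apex S)"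
  "\<pi>\<^sub>0 (map_span F S) = farr F (\<pi>\<^sub>0 S)"
  "\<pi>\<^sub>1 (map_span F S) = farr F (\<pi>\<^sub>1 S)"
  by (simp_all add: map_span_def)

lemma map_groupoid_simps [simp]:
  "Base (map_groupoid F \<G>) = fobj F (Base \<G>)"
  "Total (map_groupoid F \<G>) = fobj F (Total \<G>)"
  "src (map_groupoid F \<G>) = farr F (src \<G>)"
  "tgt (map_groupoid F \<G>) = farr F (tgt \<G>)"
  "unit (map_groupoid F \<G>) = farr F (unit \<G>)"
  "ginv (map_groupoid F \<G>) = farr F (ginv \<G>)"
  "mult (map_groupoid F \<G>) = farr F (mult \<G>)"
  "Pairs (map_groupoid F \<G>) = map_span F (Pairs \<G>)"
  "Triples (map_groupoid F \<G>) = map_span F (Triples \<G>)"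
  by (simp_all add: map_groupoid_def)

text \<open>
  The groupoid axioms are equations between composites and pairings, and a functor preserving the
  pullbacks of composable pairs and triples preserves both.
\<close>

theorem internal_groupoid_map_groupoid:
  assumes "internal_groupoid C \<G>" and "endofunctor C F"
    and pairs: "preserves_pullback C F (tgt \<G>) (src \<G>) (Pairs \<G>)"
    and triples: "preserves_pullback C F (\<pi>\<^sub>1 (Pairs \<G>) \<cdot>\<^bsub>C\<^esub> tgt \<G>) (src \<G>) (Triples \<G>)"
  shows "internal_groupoid C (map_groupoid F \<G>)"
proof -
  interpret internal_groupoid C \<G> by fact
  interpret F: endofunctor C F by fact
  have ind: "farr F (induced C (Pairs \<G>) a b) = induced C (map_span F (Pairs \<G>)) (farr F a) (farr F b)"
    if "composable x a b" for x a b
    using F.farr_induced[OF Pairs_pullback pairs] that structure_homs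
    by (auto simp: composable_def)
  have gmult: "farr F (gmult a b) =
      induced C (map_span F (Pairs \<G>)) (farr F a) (farr F b) \<cdot>\<^bsub>C\<^esub> farr F (mult \<G>)"
    if "composable x a b" for x a b
    using F.farr_Comp[OF induced_Pairs(1)[OF that] mult_hom] ind[OF that] by (simp add: gmult_def)
  note T = composable_Triples
  note fcomp = F.farr_Comp[OF unit_hom src_hom] F.farr_Comp[OF unit_hom tgt_hom]
    F.farr_Comp[OF src_hom unit_hom] F.farr_Comp[OF tgt_hom unit_hom]
    F.farr_Comp[OF mult_hom src_hom] F.farr_Comp[OF mult_hom tgt_hom]
    F.farr_Comp[OF ginv_hom src_hom] F.farr_Comp[OF ginv_hom tgt_hom]
    F.farr_Comp[OF Pairs_projections(1) src_hom] F.farr_Comp[OF Pairs_projections(2) tgt_hom]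
    F.farr_Comp[OF Triples_projections(1) Pairs_projections(1)]
    F.farr_Comp[OF Triples_projections(1) Pairs_projections(2)]
    F.farr_Comp[OF Triples_projections(1) mult_hom]
    F.farr_Ide[OF Base_Obj] F.farr_Ide[OF Total_Obj]
  note fhom = src_hom[THEN F.farr_hom] tgt_hom[THEN F.farr_hom] unit_hom[THEN F.farr_hom]
    ginv_hom[THEN F.farr_hom] mult_hom[THEN F.farr_hom]
  have assoc: "farr F (gmult (\<pi>\<^sub>0 (Triples \<G>) \<cdot>\<^bsub>C\<^esub> mult \<G>) (\<pi>\<^sub>1 (Triples \<G>))) =
      farr F (gmult (\<pi>\<^sub>0 (Triples \<G>) \<cdot>\<^bsub>C\<^esub> \<pi>\<^sub>0 (Pairs \<G>))
        (gmult (\<pi>\<^sub>0 (Triples \<G>) \<cdot>\<^bsub>C\<^esub> \<pi>\<^sub>1 (Pairs \<G>)) (\<pi>\<^sub>1 (Triples \<G>))))"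
    using mult_assoc by (simp add: gmult_def)
  \<comment> \<open>The cases singled out are the category, the two pullbacks and the laws that involve a pairing; the
    remaining ones are typings and equations between plain composites.\<close>
  show ?thesis
  proof (intro internal_groupoid.intro internal_groupoid_axioms.intro, goal_cases)
    case 1 show ?case by (rule category_axioms)
  next
    case 8 show ?case using pairs by (simp add: preserves_pullback_def)
  next
    case 9 show ?case using triples by (simp add: preserves_pullback_def fcomp)
  next
    case 15 show ?case using gmult[OF composable_unit_right] mult_unit_right
      by (simp add: gmult_def fcomp)
  next
    case 16 show ?case using gmult[OF composable_unit_left] mult_unit_left
      by (simp add: gmult_def fcomp)
  next
    case 17 show ?case using assoc
      by (simp add: gmult[OF T(2)] gmult[OF T(3)] gmult[OF T(4)] fcomp)
  next
    case 20 show ?case using gmult[OF composable_ginv_right] mult_ginv_right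
      by (simp add: gmult_def fcomp)
  next
    case 21 show ?case using gmult[OF composable_ginv_left] mult_ginv_left
      by (simp add: gmult_def fcomp)
  qed (use fhom F.fobj_Obj Base_Obj Total_Obj unit_src unit_tgt mult_src mult_tgt ginv_src ginv_tgt
        in \<open>simp_all flip: fcomp\<close>)
qed

section \<open>The action of the groupoid on its source-vertical tangent vectors\<close>

locale left_invariant_fields =
  internal_groupoid C \<G> + T: endofunctor C T +
  p: natural_transformation C T identity_functor p +
  z: natural_transformation C identity_functor T z
  for C :: "('o, 'm) category_data" (structure)
    and T :: "('o, 'm) endofunctor_data"
    and p z :: "'o \<Rightarrow> 'm"
    and \<G> :: "('o, 'm) groupoid_data" +
  fixes TsG TsMG GTsG :: "('o, 'm) span"
  assumes zero_section: "a \<in> Obj C \<Longrightarrow> z a \<cdot> p a = Ide C a"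
    and preserves_Pairs: "preserves_pullback C T (tgt \<G>) (src \<G>) (Pairs \<G>)"
    and preserves_Triples: "preserves_pullback C T (\<pi>\<^sub>1 (Pairs \<G>) \<cdot> tgt \<G>) (src \<G>) (Triples \<G>)"
    and TsG_pullback: "is_pullback C (farr T (src \<G>)) (z (Base \<G>)) TsG"
    and TsMG_pullback: "is_pullback C (p_s C p \<G> TsG) (unit \<G>) TsMG"
    and GTsG_pullback: "is_pullback C (tgt \<G>) (\<pi>\<^sub>1 TsG) GTsG"
begin

interpretation TG: internal_groupoid C "map_groupoid T \<G>"
  using internal_groupoid_map_groupoid[OF internal_groupoid_axioms T.endofunctor_axioms
      preserves_Pairs preserves_Triples] .

abbreviation "G \<equiv> Total \<G>"
abbreviation "M \<equiv> Base \<G>"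
abbreviation "s \<equiv> src \<G>"
abbreviation "t \<equiv> tgt \<G>"
abbreviation "e \<equiv> unit \<G>"
abbreviation "\<iota> \<equiv> \<pi>\<^sub>0 TsG"
abbreviation "\<pi>s \<equiv> \<pi>\<^sub>1 TsG"
abbreviation "ps \<equiv> p_s C p \<G> TsG"
abbreviation "\<mu>s \<equiv> mu_s C T z \<G> TsG GTsG"

notation gmult (infixl "\<odot>" 72)
notation TG.gmult (infixl "\<bullet>" 72)

lemma z_hom: "a \<in> Obj C \<Longrightarrow> z a \<in> hom C a (fobj T a)"
  using z.component_hom[of a] by (simp add: identity_functor_def)

lemma p_hom: "a \<in> Obj C \<Longrightarrow> p a \<in> hom C (fobj T a) a"
  using p.component_hom[of a] by (simp add: identity_functor_def)

lemma z_natural: "f \<in> hom C a b \<Longrightarrow> f \<cdot> z b = z a \<cdot> farr T f"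
  using z.naturality[of f a b] by (simp add: identity_functor_def)

lemma p_natural: "f \<in> hom C a b \<Longrightarrow> farr T f \<cdot> p b = p a \<cdot> f"
  using p.naturality[of f a b] by (simp add: identity_functor_def)

lemmas z_homs = z_hom[OF Total_Obj] z_hom[OF Base_Obj]
lemmas p_homs = p_hom[OF Total_Obj] p_hom[OF Base_Obj]

lemma TsG_projections:
  "\<iota> \<in> hom C (Apex TsG) (fobj T G)" "\<pi>s \<in> hom C (Apex TsG) M"
  "\<iota> \<cdot> farr T s = \<pi>s \<cdot> z M"
  using pullback_projections[OF TsG_pullback] T.farr_hom[OF src_hom, THEN hom_D]
    z_homs[THEN hom_D] by auto

lemma ps_hom: "ps \<in> hom C (Apex TsG) G"
  unfolding p_s_def by (rule Comp_hom[OF TsG_projections(1) p_homs(1)])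

lemmas homs = structure_homs TG.structure_homs[simplified] z_homs[THEN hom_D] p_homs[THEN hom_D]
  TsG_projections(1,2)[THEN hom_D] ps_hom[THEN hom_D]

text \<open>
  The base point of a source-vertical tangent vector is the source of its foot: cancel the zero
  section in the defining square with \<open>p\<close>.
\<close>

lemma ps_src: "ps \<cdot> s = \<pi>s"
proof -
  have "\<pi>s = \<pi>s \<cdot> z M \<cdot> p M"
    using zero_section[OF Base_Obj] homs Base_Obj by (simp add: arrow_simps)
  also have "\<dots> = \<iota> \<cdot> (farr T s \<cdot> p M)"
    using homs by (simp add: TsG_projections(3)[symmetric] arrow_simps)
  also have "\<dots> = ps \<cdot> s"
    using homs by (simp add: p_natural[OF src_hom] p_s_def arrow_simps)
  finally show ?thesis by simp
qed

text \<open>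
  Since \<open>\<pi>s\<close> is recovered from \<open>\<iota>\<close>, elements of \<open>T\<^sup>sG\<close> may be compared in \<open>TG\<close>.
\<close>

lemma TsG_eqI:
  assumes Y: "Y \<in> hom C x (Apex TsG)" and Y': "Y' \<in> hom C x (Apex TsG)"
    and eq: "Y \<cdot> \<iota> = Y' \<cdot> \<iota>"
  shows "Y = Y'"
proof (rule pullback_eqI[OF TsG_pullback Y Y' eq])
  have "Y \<cdot> \<pi>s = (Y \<cdot> \<iota>) \<cdot> (p G \<cdot> s)"
    unfolding ps_src[symmetric] p_s_def using homs hom_D[OF Y] by (simp add: arrow_simps)
  also have "\<dots> = Y' \<cdot> \<pi>s"
    unfolding eq ps_src[symmetric] p_s_def using homs hom_D[OF Y'] by (simp add: arrow_simps)
  finally show "Y \<cdot> \<pi>s = Y' \<cdot> \<pi>s" .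
qed

lemma composable_zero:
  assumes "composable x a b"
  shows "TG.composable x (a \<cdot> z G) (b \<cdot> z G)"
proof -
  have a: "a \<in> hom C x G" and b: "b \<in> hom C x G" and ab: "a \<cdot> t = b \<cdot> s"
    using assms by (auto simp: composable_def)
  have "a \<cdot> z G \<cdot> farr T t = a \<cdot> t \<cdot> z M" "b \<cdot> z G \<cdot> farr T s = b \<cdot> s \<cdot> z M"
    using homs hom_D[OF a] hom_D[OF b]
    by (simp_all add: arrow_simps z_natural[OF tgt_hom] z_natural[OF src_hom])
  with ab show ?thesis
    using Comp_hom[OF a z_homs(1)] Comp_hom[OF b z_homs(1)] by (simp add: TG.composable_def)
qed

text \<open>
  \<open>0 : G \<rightarrow> TG\<close> and \<open>p : TG \<rightarrow> G\<close> are multiplicative: naturality at the two projections moves them inside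
  the pairing, where they become the component at the object of composable pairs, and naturality at
  \<open>mult\<close> moves that component past the multiplication.
\<close>

lemma gmult_zero:
  assumes ab: "composable x a b"
  shows "(a \<odot> b) \<cdot> z G = (a \<cdot> z G) \<bullet> (b \<cdot> z G)"
proof -
  let ?ab = "induced C (Pairs \<G>) a b" and ?P = "Apex (Pairs \<G>)"
  note ind = induced_Pairs[OF ab] and pr = Pairs_projections
  have P: "?P \<in> Obj C" using hom_Obj(1)[OF pr(1)] .
  note zP = z_hom[OF P]
  note D = homs ind(1)[THEN hom_D] pr(1,2)[THEN hom_D] pr(1,2)[THEN T.farr_hom, THEN hom_D]
    zP[THEN hom_D]
  have "induced C (map_span T (Pairs \<G>)) (a \<cdot> z G) (b \<cdot> z G) = ?ab \<cdot> z ?P"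
  proof (rule induced_eqI[OF TG.Pairs_pullback[simplified]])
    show "?ab \<cdot> z ?P \<in> hom C x (Apex (map_span T (Pairs \<G>)))"
      using Comp_hom[OF ind(1) zP] by simp
    have "?ab \<cdot> z ?P \<cdot> farr T (\<pi>\<^sub>0 (Pairs \<G>)) = ?ab \<cdot> \<pi>\<^sub>0 (Pairs \<G>) \<cdot> z G"
      using D by (simp add: arrow_simps z_natural[OF pr(1)])
    then show "?ab \<cdot> z ?P \<cdot> \<pi>\<^sub>0 (map_span T (Pairs \<G>)) = a \<cdot> z G" using ind by simp
    have "?ab \<cdot> z ?P \<cdot> farr T (\<pi>\<^sub>1 (Pairs \<G>)) = ?ab \<cdot> \<pi>\<^sub>1 (Pairs \<G>) \<cdot> z G"
      using D by (simp add: arrow_simps z_natural[OF pr(2)])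
    then show "?ab \<cdot> z ?P \<cdot> \<pi>\<^sub>1 (map_span T (Pairs \<G>)) = b \<cdot> z G" using ind by simp
  qed
  then show ?thesis
    using D by (simp add: gmult_def TG.gmult_def arrow_simps z_natural[OF mult_hom])
qed

lemma gmult_p:
  assumes AB: "TG.composable x A B"
  shows "(A \<bullet> B) \<cdot> p G = (A \<cdot> p G) \<odot> (B \<cdot> p G)"
proof -
  let ?AB = "induced C (map_span T (Pairs \<G>)) A B" and ?P = "Apex (Pairs \<G>)"
  note ind = TG.induced_Pairs[OF AB, simplified] and pr = Pairs_projections
  have P: "?P \<in> Obj C" using hom_Obj(1)[OF pr(1)] .
  note pP = p_hom[OF P]
  note D = homs ind(1)[THEN hom_D] pr(1,2)[THEN hom_D] pr(1,2)[THEN T.farr_hom, THEN hom_D]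
    pP[THEN hom_D]
  have "induced C (Pairs \<G>) (A \<cdot> p G) (B \<cdot> p G) = ?AB \<cdot> p ?P"
  proof (rule induced_eqI[OF Pairs_pullback])
    show "?AB \<cdot> p ?P \<in> hom C x (Apex (Pairs \<G>))"
      using Comp_hom[OF ind(1) pP] by simp
    have "?AB \<cdot> p ?P \<cdot> \<pi>\<^sub>0 (Pairs \<G>) = ?AB \<cdot> farr T (\<pi>\<^sub>0 (Pairs \<G>)) \<cdot> p G"
      using D by (simp add: arrow_simps p_natural[OF pr(1)])
    then show "?AB \<cdot> p ?P \<cdot> \<pi>\<^sub>0 (Pairs \<G>) = A \<cdot> p G" using ind by simp
    have "?AB \<cdot> p ?P \<cdot> \<pi>\<^sub>1 (Pairs \<G>) = ?AB \<cdot> farr T (\<pi>\<^sub>1 (Pairs \<G>)) \<cdot> p G"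
      using D by (simp add: arrow_simps p_natural[OF pr(2)])
    then show "?AB \<cdot> p ?P \<cdot> \<pi>\<^sub>1 (Pairs \<G>) = B \<cdot> p G" using ind by simp
  qed
  then show ?thesis
    using D by (simp add: gmult_def TG.gmult_def arrow_simps p_natural[OF mult_hom])
qed

text \<open>The compatibility condition under which \<open>(a, Y)\<close> is an arrow into the domain of \<open>\<mu>\<^sup>s\<close>.\<close>

definition actable :: "'o \<Rightarrow> 'm \<Rightarrow> 'm \<Rightarrow> bool" where
  "actable x a Y \<longleftrightarrow> a \<in> hom C x G \<and> Y \<in> hom C x (Apex TsG) \<and> a \<cdot> t = Y \<cdot> \<pi>s"

definition act :: "'m \<Rightarrow> 'm \<Rightarrow> 'm"  (infixr "\<star>" 71) where
  "a \<star> Y = induced C GTsG a Y \<cdot> \<mu>s"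

lemma GTsG_projections:
  "\<pi>\<^sub>0 GTsG \<in> hom C (Apex GTsG) G" "\<pi>\<^sub>1 GTsG \<in> hom C (Apex GTsG) (Apex TsG)"
  "\<pi>\<^sub>0 GTsG \<cdot> t = \<pi>\<^sub>1 GTsG \<cdot> \<pi>s"
  using pullback_projections[OF GTsG_pullback] homs by auto

lemma induced_GTsG:
  assumes "actable x a Y"
  shows "induced C GTsG a Y \<in> hom C x (Apex GTsG)"
    and "induced C GTsG a Y \<cdot> \<pi>\<^sub>0 GTsG = a" and "induced C GTsG a Y \<cdot> \<pi>\<^sub>1 GTsG = Y"
  using induced_into_pullback[OF GTsG_pullback] assms homs by (auto simp: actable_def)

lemma composable_actable:
  assumes "actable x a Y"
  shows "TG.composable x (a \<cdot> z G) (Y \<cdot> \<iota>)"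
proof -
  have a: "a \<in> hom C x G" and Y: "Y \<in> hom C x (Apex TsG)" and aY: "a \<cdot> t = Y \<cdot> \<pi>s"
    using assms by (auto simp: actable_def)
  have "a \<cdot> z G \<cdot> farr T t = a \<cdot> t \<cdot> z M" "Y \<cdot> \<iota> \<cdot> farr T s = Y \<cdot> \<pi>s \<cdot> z M"
    using homs hom_D[OF a] hom_D[OF Y]
    by (simp_all add: arrow_simps z_natural[OF tgt_hom] TsG_projections(3))
  with aY show ?thesis
    using Comp_hom[OF a z_homs(1)] Comp_hom[OF Y TsG_projections(1)]
    by (simp add: TG.composable_def)
qed

lemma mu_s_properties:
  shows "\<mu>s \<in> hom C (Apex GTsG) (Apex TsG)"
    and "\<mu>s \<cdot> \<iota> = (\<pi>\<^sub>0 GTsG \<cdot> z G) \<bullet> (\<pi>\<^sub>1 GTsG \<cdot> \<iota>)"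
    and "\<mu>s \<cdot> \<pi>s = \<pi>\<^sub>0 GTsG \<cdot> s"
proof -
  let ?A = "\<pi>\<^sub>0 GTsG \<cdot> z G" and ?B = "\<pi>\<^sub>1 GTsG \<cdot> \<iota>"
  have AB: "TG.composable (Apex GTsG) ?A ?B"
    using GTsG_projections by (intro composable_actable) (simp add: actable_def)
  have "(?A \<bullet> ?B) \<cdot> farr T s = \<pi>\<^sub>0 GTsG \<cdot> s \<cdot> z M"
    using TG.gmult_src[OF AB] homs GTsG_projections(1)[THEN hom_D]
    by (simp add: arrow_simps z_natural[OF src_hom])
  moreover have "?A \<bullet> ?B \<in> hom C (Apex GTsG) (fobj T G)"
    using TG.gmult_hom[OF AB] by simp
  moreover have "\<pi>\<^sub>0 GTsG \<cdot> s \<in> hom C (Apex GTsG) M"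
    by (rule Comp_hom[OF GTsG_projections(1) src_hom])
  ultimately have *: "?A \<bullet> ?B \<in> hom C (Apex GTsG) (Dom C (farr T s))"
    "\<pi>\<^sub>0 GTsG \<cdot> s \<in> hom C (Apex GTsG) (Dom C (z M))"
    "(?A \<bullet> ?B) \<cdot> farr T s = \<pi>\<^sub>0 GTsG \<cdot> s \<cdot> z M"
    using homs by auto
  have "\<mu>s = induced C TsG (?A \<bullet> ?B) (\<pi>\<^sub>0 GTsG \<cdot> s)"
    by (simp add: mu_s_def TG.gmult_def)
  then show "\<mu>s \<in> hom C (Apex GTsG) (Apex TsG)" "\<mu>s \<cdot> \<iota> = ?A \<bullet> ?B" "\<mu>s \<cdot> \<pi>s = \<pi>\<^sub>0 GTsG \<cdot> s"
    using induced_into_pullback[OF TsG_pullback *] by simp_all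
qed

lemma act_hom: "actable x a Y \<Longrightarrow> a \<star> Y \<in> hom C x (Apex TsG)"
  unfolding act_def by (blast intro: Comp_hom induced_GTsG mu_s_properties)

text \<open>
  \<open>\<mu>\<^sup>s\<close> is defined by its value on the universal pair; precomposing with the arrow \<open>(a, Y)\<close> gives its
  value on every pair, and reduces the laws of the action to those of the groupoid \<open>TG\<close>.
\<close>

lemma act_iota:
  assumes "actable x a Y"
  shows "(a \<star> Y) \<cdot> \<iota> = (a \<cdot> z G) \<bullet> (Y \<cdot> \<iota>)"
proof -
  let ?h = "induced C GTsG a Y"
  note ind = induced_GTsG[OF assms] and pr = GTsG_projections
  have "TG.composable (Apex GTsG) (\<pi>\<^sub>0 GTsG \<cdot> z G) (\<pi>\<^sub>1 GTsG \<cdot> \<iota>)"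
    using pr by (intro composable_actable) (simp add: actable_def)
  from TG.Comp_gmult[OF this ind(1)] show ?thesis
    using Comp_assoc[OF ind(1) mu_s_properties(1) TsG_projections(1)]
      Comp_assoc[OF ind(1) pr(1) z_homs(1)] Comp_assoc[OF ind(1) pr(2) TsG_projections(1)] ind
    by (simp add: act_def mu_s_properties(2))
qed

lemma act_base:
  assumes "actable x a Y"
  shows "(a \<star> Y) \<cdot> \<pi>s = a \<cdot> s"
  using Comp_assoc[OF induced_GTsG(1)[OF assms] mu_s_properties(1) TsG_projections(2)]
    Comp_assoc[OF induced_GTsG(1)[OF assms] GTsG_projections(1) src_hom] induced_GTsG[OF assms]
  by (simp add: act_def mu_s_properties(3))

lemma actable_Comp:
  assumes "actable x a Y" "h \<in> hom C y x"
  shows "actable y (h \<cdot> a) (h \<cdot> Y)"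
  using assms homs by (auto simp: actable_def arrow_simps dest!: hom_D intro!: hom_I)

lemma Comp_act:
  assumes "actable x a Y" "h \<in> hom C y x"
  shows "h \<cdot> (a \<star> Y) = (h \<cdot> a) \<star> (h \<cdot> Y)"
proof -
  have "h \<cdot> induced C GTsG a Y = induced C GTsG (h \<cdot> a) (h \<cdot> Y)"
    using Comp_induced[OF GTsG_pullback _ _ _ assms(2)] assms(1) homs by (auto simp: actable_def)
  then show ?thesis
    unfolding act_def
    using Comp_assoc[OF assms(2) induced_GTsG(1)[OF assms(1)] mu_s_properties(1)] by simp
qed

text \<open>
  The action covers left multiplication, because the foot of the zero vector at \<open>a\<close> is \<open>a\<close> and
  feet multiply.
\<close>

lemma act_foot:
  assumes "actable x a Y"
  shows "(a \<star> Y) \<cdot> ps = a \<odot> (Y \<cdot> ps)"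
proof -
  have a: "a \<in> hom C x G" and Y: "Y \<in> hom C x (Apex TsG)"
    using assms by (auto simp: actable_def)
  have "(a \<star> Y) \<cdot> ps = ((a \<cdot> z G) \<bullet> (Y \<cdot> \<iota>)) \<cdot> p G"
    unfolding act_iota[OF assms, symmetric] p_s_def
    using homs hom_D[OF act_hom[OF assms]] by (simp add: arrow_simps)
  also have "\<dots> = (a \<cdot> z G \<cdot> p G) \<odot> (Y \<cdot> \<iota> \<cdot> p G)"
    by (rule gmult_p[OF composable_actable[OF assms]])
  also have "\<dots> = a \<odot> (Y \<cdot> ps)"
    using homs hom_D[OF a] hom_D[OF Y] zero_section[OF Total_Obj]
    by (simp add: arrow_simps p_s_def Total_Obj)
  finally show ?thesis .
qed

text \<open>Inside \<open>TG\<close> this is associativity of \<open>\<bullet>\<close>, once \<open>0\<close> has been distributed over \<open>a \<odot> b\<close>.\<close>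

lemma act_assoc:
  assumes ab: "composable x a b" and bY: "actable x b Y"
  shows "(a \<odot> b) \<star> Y = a \<star> (b \<star> Y)"
proof (rule TsG_eqI)
  have abY: "actable x (a \<odot> b) Y"
    using bY gmult_hom[OF ab] gmult_tgt[OF ab] by (simp add: actable_def)
  have a_bY: "actable x a (b \<star> Y)"
    using ab act_hom[OF bY] act_base[OF bY] by (simp add: actable_def composable_def)
  show "(a \<odot> b) \<star> Y \<in> hom C x (Apex TsG)" "a \<star> (b \<star> Y) \<in> hom C x (Apex TsG)"
    using act_hom[OF abY] act_hom[OF a_bY] .
  show "((a \<odot> b) \<star> Y) \<cdot> \<iota> = (a \<star> (b \<star> Y)) \<cdot> \<iota>"
    unfolding act_iota[OF abY] act_iota[OF a_bY] act_iota[OF bY] gmult_zero[OF ab]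
    by (rule TG.gmult_assoc[OF composable_zero[OF ab] composable_actable[OF bY]])
qed

text \<open>Naturality of \<open>0\<close> at \<open>e\<close> turns the zero vector at a unit into a unit of \<open>TG\<close>.\<close>

lemma act_unit:
  assumes Y: "Y \<in> hom C x (Apex TsG)"
  shows "(Y \<cdot> \<pi>s \<cdot> e) \<star> Y = Y"
proof (rule TsG_eqI[OF _ Y])
  have ok: "actable x (Y \<cdot> \<pi>s \<cdot> e) Y"
    using homs hom_D[OF Y] unit_tgt Y
    by (auto simp: actable_def arrow_simps intro!: hom_I)
  show "(Y \<cdot> \<pi>s \<cdot> e) \<star> Y \<in> hom C x (Apex TsG)" by (rule act_hom[OF ok])
  have "Y \<cdot> \<pi>s \<cdot> e \<cdot> z G = Y \<cdot> (\<pi>s \<cdot> z M) \<cdot> farr T e"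
    using homs hom_D[OF Y] by (simp add: arrow_simps z_natural[OF unit_hom])
  also have "\<dots> = (Y \<cdot> \<iota>) \<cdot> farr T s \<cdot> farr T e"
    using homs hom_D[OF Y] by (simp add: TsG_projections(3)[symmetric] arrow_simps)
  finally show "((Y \<cdot> \<pi>s \<cdot> e) \<star> Y) \<cdot> \<iota> = Y \<cdot> \<iota>"
    using TG.gmult_unit_left[simplified, OF Comp_hom[OF Y TsG_projections(1)]]
    by (simp add: act_iota[OF ok])
qed

section \<open>Left invariant vector fields and sections\<close>

abbreviation "\<iota>M \<equiv> \<pi>\<^sub>0 TsMG"
abbreviation "\<pi>M \<equiv> \<pi>\<^sub>1 TsMG"

abbreviation left_invariant :: "'m \<Rightarrow> bool" where
  "left_invariant X \<equiv> X \<in> LeftInv C T p z \<G> TsG GTsG"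

lemma TsMG_projections:
  "\<iota>M \<in> hom C (Apex TsMG) (Apex TsG)" "\<pi>M \<in> hom C (Apex TsMG) M"
  "\<iota>M \<cdot> ps = \<pi>M \<cdot> e"
  using pullback_projections[OF TsMG_pullback] homs by auto

lemma left_invariant_iff:
  "left_invariant X \<longleftrightarrow>
     X \<in> hom C G (Apex TsG) \<and> X \<cdot> ps = Ide C G \<and>
     \<pi>\<^sub>0 (Pairs \<G>) \<star> (\<pi>\<^sub>1 (Pairs \<G>) \<cdot> X) = mult \<G> \<cdot> X"
  by (simp add: LeftInv_def act_def)

lemma wedge_eq_act: "wedge C T z \<G> TsG TsMG GTsG v = Ide C G \<star> (t \<cdot> v \<cdot> \<iota>M)"
  by (simp add: wedge_def act_def)

lemma vector_field_base:
  assumes "X \<in> hom C G (Apex TsG)" "X \<cdot> ps = Ide C G"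
  shows "X \<cdot> \<pi>s = s"
  using Comp_assoc[OF assms(1) ps_hom src_hom] assms Ide_Comp[OF src_hom] ps_src by simp

text \<open>
  The defining equation of left invariance concerns the universal composable pair; this is its
  consequence at an arbitrary one.
\<close>

lemma left_invariant_gmult:
  assumes X: "left_invariant X" and ab: "composable x a b"
  shows "(a \<odot> b) \<cdot> X = a \<star> (b \<cdot> X)"
proof -
  let ?h = "induced C (Pairs \<G>) a b"
  note ind = induced_Pairs[OF ab] and pr = Pairs_projections
  have Xh: "X \<in> hom C G (Apex TsG)" and Xs: "X \<cdot> \<pi>s = s"
    using X vector_field_base by (auto simp: left_invariant_iff)
  have ok: "actable (Apex (Pairs \<G>)) (\<pi>\<^sub>0 (Pairs \<G>)) (\<pi>\<^sub>1 (Pairs \<G>) \<cdot> X)"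
    using pr Comp_hom[OF pr(2) Xh] Comp_assoc[OF pr(2) Xh TsG_projections(2)] Xs
    by (simp add: actable_def)
  have "(a \<odot> b) \<cdot> X = ?h \<cdot> (mult \<G> \<cdot> X)"
    unfolding gmult_def by (rule Comp_assoc[OF ind(1) mult_hom Xh])
  also have "\<dots> = a \<star> (b \<cdot> X)"
    using X Comp_act[OF ok ind(1)] Comp_assoc[OF ind(1) pr(2) Xh] ind
    by (simp add: left_invariant_iff)
  finally show ?thesis .
qed

lemma induced_vee:
  assumes X: "X \<in> hom C G (Apex TsG)" "X \<cdot> ps = Ide C G"
  shows "vee C \<G> TsMG X \<in> hom C M (Apex TsMG)"
    and "vee C \<G> TsMG X \<cdot> \<iota>M = e \<cdot> X" and "vee C \<G> TsMG X \<cdot> \<pi>M = Ide C M"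
proof -
  have "e \<cdot> X \<cdot> ps = Ide C M \<cdot> e"
    using Comp_assoc[OF unit_hom X(1) ps_hom] X(2) Comp_Ide[OF unit_hom] Ide_Comp[OF unit_hom]
    by simp
  then have *: "e \<cdot> X \<in> hom C M (Dom C ps)" "Ide C M \<in> hom C M (Dom C e)"
    "e \<cdot> X \<cdot> ps = Ide C M \<cdot> e"
    using Comp_hom[OF unit_hom X(1)] Ide_hom[OF Base_Obj] homs by auto
  show "vee C \<G> TsMG X \<in> hom C M (Apex TsMG)" "vee C \<G> TsMG X \<cdot> \<iota>M = e \<cdot> X"
    "vee C \<G> TsMG X \<cdot> \<pi>M = Ide C M"
    using induced_into_pullback[OF TsMG_pullback *] by (simp_all add: vee_def)
qed

theorem vee_section:
  assumes "left_invariant X"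
  shows "vee C \<G> TsMG X \<in> sections C \<G> TsMG"
  using induced_vee assms by (simp add: left_invariant_iff sections_def)

lemma section_vector:
  assumes "v \<in> sections C \<G> TsMG"
  shows "v \<cdot> \<iota>M \<in> hom C M (Apex TsG)" and "v \<cdot> \<iota>M \<cdot> ps = e" and "v \<cdot> \<iota>M \<cdot> \<pi>s = Ide C M"
proof -
  have v: "v \<in> hom C M (Apex TsMG)" and v1: "v \<cdot> \<pi>M = Ide C M"
    using assms by (auto simp: sections_def)
  show w: "v \<cdot> \<iota>M \<in> hom C M (Apex TsG)" by (rule Comp_hom[OF v TsMG_projections(1)])
  show foot: "v \<cdot> \<iota>M \<cdot> ps = e"
    using Comp_assoc[OF v TsMG_projections(1) ps_hom] Comp_assoc[OF v TsMG_projections(2) unit_hom]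
      v1 TsMG_projections(3) Ide_Comp[OF unit_hom] by simp
  show "v \<cdot> \<iota>M \<cdot> \<pi>s = Ide C M"
    using Comp_assoc[OF w ps_hom src_hom] foot unit_src ps_src by simp
qed

lemma actable_wedge:
  assumes "v \<in> sections C \<G> TsMG"
  shows "actable G (Ide C G) (t \<cdot> (v \<cdot> \<iota>M))"
  using Ide_hom[OF Total_Obj] section_vector[OF assms] Comp_hom[OF tgt_hom section_vector(1)[OF assms]]
    Comp_assoc[OF tgt_hom section_vector(1)[OF assms] TsG_projections(2)]
    Ide_Comp[OF tgt_hom] Comp_Ide[OF tgt_hom]
  by (simp add: actable_def)

lemma wedge_act:
  assumes "v \<in> sections C \<G> TsMG"
  shows "wedge C T z \<G> TsG TsMG GTsG v = Ide C G \<star> (t \<cdot> (v \<cdot> \<iota>M))"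
  using Comp_assoc[OF tgt_hom _ TsMG_projections(1)] assms by (auto simp: wedge_eq_act sections_def)

text \<open>
  The pointwise formula \<open>v\<^sup>\<and>(g) = g \<star> v(t g)\<close>, which reduces statements about \<open>v\<^sup>\<and>\<close> to laws of the
  action.
\<close>

lemma Comp_wedge:
  assumes v: "v \<in> sections C \<G> TsMG" and g: "g \<in> hom C x G"
  shows "g \<cdot> wedge C T z \<G> TsG TsMG GTsG v = g \<star> (g \<cdot> t \<cdot> (v \<cdot> \<iota>M))"
  unfolding wedge_act[OF v] Comp_act[OF actable_wedge[OF v] g] Comp_Ide[OF g]
  using Comp_assoc[OF g tgt_hom section_vector(1)[OF v]] by simp

lemma actable_wedge_at:
  assumes v: "v \<in> sections C \<G> TsMG" and g: "g \<in> hom C x G"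
  shows "actable x g (g \<cdot> t \<cdot> (v \<cdot> \<iota>M))"
  using actable_Comp[OF actable_wedge[OF v] g] Comp_Ide[OF g]
    Comp_assoc[OF g tgt_hom section_vector(1)[OF v]] by simp

text \<open>
  Left invariance of \<open>v\<^sup>\<and>\<close> is associativity of the action, because \<open>g \<odot> h\<close> and \<open>h\<close> have the same
  target.
\<close>

theorem wedge_left_invariant:
  assumes v: "v \<in> sections C \<G> TsMG"
  shows "left_invariant (wedge C T z \<G> TsG TsMG GTsG v)" (is "left_invariant ?X")
proof -
  let ?w = "v \<cdot> \<iota>M" and ?a = "\<pi>\<^sub>0 (Pairs \<G>)" and ?b = "\<pi>\<^sub>1 (Pairs \<G>)"
  note w = section_vector[OF v] and pr = Pairs_projections
  have "?X \<in> hom C G (Apex TsG)"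
    unfolding wedge_act[OF v] by (rule act_hom[OF actable_wedge[OF v]])
  moreover have "?X \<cdot> ps = Ide C G"
    unfolding wedge_act[OF v] act_foot[OF actable_wedge[OF v]]
    using Comp_assoc[OF tgt_hom w(1) ps_hom] w(2) mult_unit_right by (simp add: gmult_def)
  moreover have "?a \<star> (?b \<cdot> ?X) = mult \<G> \<cdot> ?X"
  proof -
    have "?a \<star> (?b \<cdot> ?X) = ?a \<star> (?b \<star> (?b \<cdot> t \<cdot> ?w))"
      by (simp add: Comp_wedge[OF v pr(2)])
    also have "\<dots> = (?a \<odot> ?b) \<star> (?b \<cdot> t \<cdot> ?w)"
      by (rule act_assoc[OF composable_projections actable_wedge_at[OF v pr(2)], symmetric])
    also have "\<dots> = mult \<G> \<cdot> ?X"
      by (simp add: Comp_wedge[OF v mult_hom] gmult_projections mult_tgt)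
    finally show ?thesis .
  qed
  ultimately show ?thesis by (simp add: left_invariant_iff)
qed

text \<open>
  At a unit the pointwise formula reads \<open>1 \<star> v\<close>, and units act trivially. The second component of
  the arrow into \<open>T\<^sup>s\<^sub>MG\<close> agrees because \<open>v\<close> is a section.
\<close>

theorem vee_wedge:
  assumes v: "v \<in> sections C \<G> TsMG"
  shows "vee C \<G> TsMG (wedge C T z \<G> TsG TsMG GTsG v) = v" (is "vee C \<G> TsMG ?X = v")
proof -
  note w = section_vector[OF v]
  have "e \<cdot> ?X = e \<star> (v \<cdot> \<iota>M)"
    using Comp_wedge[OF v unit_hom] unit_tgt Ide_Comp[OF w(1)] by simp
  also have "\<dots> = v \<cdot> \<iota>M"
    using act_unit[OF w(1)] w(3) Ide_Comp[OF unit_hom] by simp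
  finally have "v \<cdot> \<iota>M = e \<cdot> ?X" by simp
  with v show ?thesis
    unfolding vee_def by (intro induced_eqI[OF TsMG_pullback]) (auto simp: sections_def)
qed

text \<open>
  Left invariance of \<open>X\<close>, applied to the composable pair of \<open>g\<close> and the unit at its target, turns
  \<open>g \<star> X(1)\<close> into \<open>X(g \<odot> 1) = X(g)\<close>.
\<close>

theorem wedge_vee:
  assumes X: "left_invariant X"
  shows "wedge C T z \<G> TsG TsMG GTsG (vee C \<G> TsMG X) = X"
proof -
  have Xh: "X \<in> hom C G (Apex TsG)" and Xp: "X \<cdot> ps = Ide C G"
    using X by (auto simp: left_invariant_iff)
  have "wedge C T z \<G> TsG TsMG GTsG (vee C \<G> TsMG X) = Ide C G \<star> (t \<cdot> e \<cdot> X)"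
    using wedge_act[OF vee_section[OF X]] induced_vee(2)[OF Xh Xp] Comp_assoc[OF tgt_hom unit_hom Xh]
    by simp
  also have "\<dots> = (Ide C G \<odot> (t \<cdot> e)) \<cdot> X"
    by (rule left_invariant_gmult[OF X composable_unit_right, symmetric])
  also have "\<dots> = X"
    using mult_unit_right Ide_Comp[OF Xh] by (simp add: gmult_def)
  finally show ?thesis .
qed

end

theorem proposition2p10:
  fixes C :: "('o, 'm) category_data"
    and T :: "('o, 'm) endofunctor_data"
    and p z :: "'o \<Rightarrow> 'm"
    and \<G> :: "('o, 'm) groupoid_data"
    and TsG TsMG GTsG :: "('o, 'm) span"
  assumes "category C"
    and "endofunctor C T"
    and "natural_transformation C T identity_functor p"
    and "natural_transformation C identity_functor T z"
    and "\<And>a. a \<in> Obj C \<Longrightarrow> z a \<cdot>\<^bsub>C\<^esub> p a = Ide C a"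
    and "internal_groupoid C \<G>"
    and "preserves_pullback C T (tgt \<G>) (src \<G>) (Pairs \<G>)"
    and "preserves_pullback C T (\<pi>\<^sub>1 (Pairs \<G>) \<cdot>\<^bsub>C\<^esub> tgt \<G>) (src \<G>) (Triples \<G>)"
    and "is_pullback C (farr T (src \<G>)) (z (Base \<G>)) TsG"
    and "preserves_pullback C T (farr T (src \<G>)) (z (Base \<G>)) TsG"
    and "is_pullback C (p_s C p \<G> TsG) (unit \<G>) TsMG"
    and "preserves_pullback C T (p_s C p \<G> TsG) (unit \<G>) TsMG"
    and "is_pullback C (tgt \<G>) (\<pi>\<^sub>1 TsG) GTsG"
    and "preserves_pullback C T (tgt \<G>) (\<pi>\<^sub>1 TsG) GTsG"
  shows "(\<forall>X \<in> LeftInv C T p z \<G> TsG GTsG. vee C \<G> TsMG X \<in> sections C \<G> TsMG) \<and>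
         (\<forall>v \<in> sections C \<G> TsMG. wedge C T z \<G> TsG TsMG GTsG v \<in> LeftInv C T p z \<G> TsG GTsG) \<and>
         (\<forall>v \<in> sections C \<G> TsMG. vee C \<G> TsMG (wedge C T z \<G> TsG TsMG GTsG v) = v) \<and>
         (\<forall>X \<in> LeftInv C T p z \<G> TsG GTsG. wedge C T z \<G> TsG TsMG GTsG (vee C \<G> TsMG X) = X)"
proof -
  interpret left_invariant_fields C T p z \<G> TsG TsMG GTsG
    by (intro left_invariant_fields.intro left_invariant_fields_axioms.intro) (fact assms)+
  show ?thesis
    using vee_section wedge_left_invariant vee_wedge wedge_vee by blast
qed

end
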